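(* Let $f=\sum_{i=1}^m f_i$ with $f_i:\mathbb{R}^d\to\mathbb{R}$. Assume that: (i) each $f_i$ is convex and has $L$-Lipschitz continuous gradient, i.e. $f_i(x)+\langle\nabla f_i(x),y-x\rangle\le f_i(y)\le f_i(x)+\langle\nabla f_i(x),y-x\rangle+\frac L2\|y-x\|^2$ for all $x,y\in\mathbb{R}^d$; (ii) $f$ is $\mu$-strongly convex with $\mu>0$; (iii) $f_i(x)=\ell(a_i^Tx,b_i)$ with $a_i\in\mathbb{R}^d$, $b_i\in\mathbb{R}$, and $\mathrm{supp}(\nabla f_i(x))=\mathrm{supp}(a_i)$ for every $x$ and $i$. Let $\Delta=\min(\Delta_{\rm ave},\Delta_{\max})$ and $\bar L=L\sqrt{m(1+\Delta)}$. Let $Q$ be an unbiased random quantizer with variance parameter $\alpha$. Then the iterates $x_{k+1}=x_k-\gamma_kQ(\nabla f(x_k))$ with $\gamma_k=\frac1\alpha\cdot\frac{2}{\mu+\bar L}$ satisfy, for all $k\in\mathbb{N}$, $$\mathbf{E}\|x_k-x^\star\|^2\le\rho^k\|x_0-x^\star\|^2,\qquad \rho=1-\frac1\alpha\,\frac{4\mu\bar L}{(\mu+\bar L)^2}.$$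
   Context: $\|\cdot\|$ is the Euclidean norm and $\mathrm{supp}(x)=\{i: x^i\ne0\}$ for a vector $x$ with entries $x^i$. $x^\star$ is the minimizer of $f$. $x_0\in\mathbb{R}^d$ is a deterministic initial point. Conflict graph degrees: $\Delta_{\rm ave}=\frac1m\sum_{i=1}^m\sum_{j\ne i}\mathbf 1\{\mathrm{supp}(a_i)\cap\mathrm{supp}(a_j)\ne\emptyset\}$ and $\Delta_{\max}=\max_{i}\sum_{j\ne i}\mathbf 1\{\mathrm{supp}(a_i)\cap\mathrm{supp}(a_j)\ne\emptyset\}$. An unbiased random quantizer (URQ) with parameter $\alpha$ (finite, positive) is a random mapping $Q:\mathbb{R}^d\to\mathbb{R}^d$ such that for every $v\in\mathbb{R}^d$: $\mathrm{supp}(Q(v))\subseteq\mathrm{supp}(v)$, $\mathbf{E}\{Q(v)\}=v$, and $\mathbf{E}\{\|Q(v)\|^2\}\le\alpha\|v\|^2$. Each application of $Q$ in the algorithm uses fresh randomness, so these properties hold conditionally on the past iterates. *)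

theory Defs
  imports "HOL-Analysis.Analysis" "HOL-Probability.Probability"
begin

text \<open>The gradient; meaningful where the function is differentiable.\<close>

definition grad :: "('v::real_inner \<Rightarrow> real) \<Rightarrow> 'v \<Rightarrow> 'v" where
  "grad f x = (THE D. GDERIV f x :> D)"

lemma grad_eqI:
  assumes "GDERIV f x :> D"
  shows "grad f x = D"
  unfolding grad_def
proof (rule the_equality)
  show "GDERIV f x :> D" by (rule assms)
next
  fix D' assume "GDERIV f x :> D'"
  then have "(\<lambda>h. h \<bullet> D') = (\<lambda>h. h \<bullet> D)"
    using assms unfolding gderiv_def by (rule has_derivative_unique)
  then show "D' = D"
    by (metis inner_commute vector_eq_rdot)
qed

lemma GDERIV_grad:
  fixes f :: "'v::euclidean_space \<Rightarrow> real"
  assumes "f differentiable (at x)"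
  shows "GDERIV f x :> grad f x"
proof -
  from assms obtain f' where f': "(f has_derivative f') (at x)"
    unfolding differentiable_def by blast
  then interpret f': bounded_linear f' by (rule has_derivative_bounded_linear)
  have "f' = (\<lambda>h. h \<bullet> adjoint f' 1)"
    using adjoint_works[OF f'.linear, of _ 1] by (auto simp: fun_eq_iff)
  with f' have "GDERIV f x :> adjoint f' 1"
    unfolding gderiv_def by simp
  then show ?thesis
    using grad_eqI by metis
qed

definition strongly_convex :: "real \<Rightarrow> ('v::real_inner \<Rightarrow> real) \<Rightarrow> bool" where
  "strongly_convex \<mu> f \<longleftrightarrow>
     (\<forall>x y. \<forall>t\<in>{0..1}. f (t *\<^sub>R x + (1 - t) *\<^sub>R y)
        \<le> t * f x + (1 - t) * f y - \<mu> / 2 * t * (1 - t) * (norm (x - y))\<^sup>2)"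

definition supp :: "real ^ 'd \<Rightarrow> 'd set" where
  "supp v = {i. v $ i \<noteq> 0}"

definition conflict_degree :: "nat \<Rightarrow> (nat \<Rightarrow> real ^ 'd) \<Rightarrow> nat \<Rightarrow> real" where
  "conflict_degree m a i = (\<Sum>j\<in>{1..m} - {i}. of_bool (supp (a i) \<inter> supp (a j) \<noteq> {}))"

definition Delta_ave :: "nat \<Rightarrow> (nat \<Rightarrow> real ^ 'd) \<Rightarrow> real" where
  "Delta_ave m a = (1 / real m) * (\<Sum>i=1..m. conflict_degree m a i)"

definition Delta_max :: "nat \<Rightarrow> (nat \<Rightarrow> real ^ 'd) \<Rightarrow> real" where
  "Delta_max m a = Max (conflict_degree m a ` {1..m})"

text \<open>A random mapping is a jointly measurable function \<open>Q s v\<close> of a random seed \<open>s\<close>,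
  distributed according to \<open>N\<close>, and of the vector \<open>v\<close>. The integrability conditions express that
  the two expectations exist and are finite (the Bochner integral of a non-integrable function
  is 0).\<close>

definition unbiased_random_quantizer ::
    "'s measure \<Rightarrow> ('s \<Rightarrow> real ^ 'd \<Rightarrow> real ^ 'd) \<Rightarrow> real \<Rightarrow> bool" where
  "unbiased_random_quantizer N Q \<alpha> \<longleftrightarrow>
     prob_space N \<and> \<alpha> > 0 \<and>
     case_prod Q \<in> borel_measurable (N \<Otimes>\<^sub>M borel) \<and>
     (\<forall>v. (AE s in N. supp (Q s v) \<subseteq> supp v) \<and>
          integrable N (\<lambda>s. Q s v) \<and> (\<integral>s. Q s v \<partial>N) = v \<and>
          integrable N (\<lambda>s. (norm (Q s v))\<^sup>2) \<and>
          (\<integral>s. (norm (Q s v))\<^sup>2 \<partial>N) \<le> \<alpha> * (norm v)\<^sup>2)"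

text \<open>Fresh randomness: the seeds used in the successive steps are independent copies of a seed
  distributed according to \<open>N\<close>.\<close>

definition fresh_seeds :: "'w measure \<Rightarrow> 's measure \<Rightarrow> (nat \<Rightarrow> 'w \<Rightarrow> 's) \<Rightarrow> bool" where
  "fresh_seeds M N \<xi> \<longleftrightarrow>
     prob_space M \<and> prob_space.indep_vars M (\<lambda>_. N) \<xi> UNIV \<and> (\<forall>k. distr M N (\<xi> k) = N)"

end

theory Submission
  imports Defs
begin

text \<open>
  The conflict graph enters only through the smoothness of the sum. Differences of gradients of
  two summands whose data vectors have disjoint supports are orthogonal, so expanding the square of
  \<open>\<nabla>F y - \<nabla>F z\<close> leaves one term for each summand and one for each ordered conflicting pair,
  \<open>m (1 + \<Delta>)\<close> terms in all with \<open>\<Delta>\<close> the average degree, and each of them is at most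
  \<open>L\<^sup>2 \<parallel>y - z\<parallel>\<^sup>2\<close>. An average is at most a maximum, so the minimum of the two degrees is the
  average one, and \<open>\<nabla>F\<close> has Lipschitz constant \<open>Lbar = L sqrt (m (1 + \<Delta>))\<close>
  (\<open>lipschitz_sum_gradients\<close>).

  A \<open>\<mu>\<close>-strongly convex function with an \<open>Lbar\<close>-Lipschitz gradient satisfies
  \<open>\<mu> Lbar \<parallel>u\<parallel>\<^sup>2 + \<parallel>v\<parallel>\<^sup>2 \<le> (\<mu> + Lbar) (v \<bullet> u)\<close>, where \<open>u\<close> is the distance vector from the
  minimizer and \<open>v\<close> is the gradient (\<open>strongly_convex_smooth_monotone\<close>). By unbiasedness and
  the variance bound, a step with fresh randomness has expected squared distance at most
  \<open>\<parallel>u\<parallel>\<^sup>2 - 2 \<gamma> (v \<bullet> u) + \<gamma>\<^sup>2 \<alpha> \<parallel>v\<parallel>\<^sup>2\<close>. The step size is the one for which the monotonicity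
  inequality cancels the \<open>\<parallel>v\<parallel>\<^sup>2\<close> term exactly; what remains is \<open>\<rho> \<parallel>u\<parallel>\<^sup>2\<close>
  (\<open>quantized_step_contraction\<close>).

  Finally, an iterate is a measurable function of the earlier seeds only, hence independent of the
  next seed, and conditioning on the past amounts to integrating out that seed alone
  (\<open>nn_integral_fresh_seed\<close>). Nonnegative integrals are used throughout the induction on the step
  number, so that integrability of the squared distances is a consequence of the bound instead of
  an additional invariant.
\<close>

section \<open>Smooth and strongly convex functions\<close>

lemma norm_sq_diff_scaleR:
  "(norm (u - c *\<^sub>R v))\<^sup>2 = (norm u)\<^sup>2 - 2 * c * (v \<bullet> u) + c\<^sup>2 * (norm v)\<^sup>2"
  by (simp add: power2_norm_eq_inner power2_eq_square[of c] inner_diff_left inner_diff_right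
      inner_commute algebra_simps)

text \<open>The lower bound at one point and the upper bound at the other are compared at the trial
  points \<open>z + t D\<close> and \<open>y - t D\<close>, where \<open>D\<close> is the difference of the gradients. Adding the two
  comparisons gives a quadratic inequality in \<open>t\<close>, which for \<open>K > 0\<close> is best at \<open>t = 1 / K\<close>. The
  case \<open>K = 0\<close> is included because it arises from strongly convex functions whose lower and upper
  curvature bounds coincide, such as \<open>\<mu> / 2 \<parallel>y\<parallel>\<^sup>2\<close>.\<close>

lemma convex_smooth_cocoercive:
  fixes f :: "'v::real_inner \<Rightarrow> real" and G :: "'v \<Rightarrow> 'v"
  assumes lower: "\<And>y z. f y + G y \<bullet> (z - y) \<le> f z"
    and upper: "\<And>y z. f z \<le> f y + G y \<bullet> (z - y) + K / 2 * (norm (z - y))\<^sup>2"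
    and K: "0 \<le> K"
  shows "(norm (G y - G z))\<^sup>2 \<le> K * ((G y - G z) \<bullet> (y - z))"
proof -
  define D where "D = G y - G z"
  have trial: "(2 * t - K * t\<^sup>2) * (norm D)\<^sup>2 \<le> D \<bullet> (y - z)" for t
  proof -
    have D2: "(norm D)\<^sup>2 = G y \<bullet> D - G z \<bullet> D"
      by (simp add: D_def power2_norm_eq_inner inner_diff_left)
    have "f y + G y \<bullet> ((z + t *\<^sub>R D) - y) \<le> f z + G z \<bullet> ((z + t *\<^sub>R D) - z) + K / 2 * (norm ((z + t *\<^sub>R D) - z))\<^sup>2"
      using lower[of y "z + t *\<^sub>R D"] upper[of "z + t *\<^sub>R D" z] by linarith
    moreover have "f z + G z \<bullet> ((y - t *\<^sub>R D) - z) \<le> f y + G y \<bullet> ((y - t *\<^sub>R D) - y) + K / 2 * (norm ((y - t *\<^sub>R D) - y))\<^sup>2"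
      using lower[of z "y - t *\<^sub>R D"] upper[of "y - t *\<^sub>R D" y] by linarith
    ultimately have "2 * (t * (G y \<bullet> D) - t * (G z \<bullet> D)) - K * (t\<^sup>2 * (norm D)\<^sup>2)
        \<le> (G y - G z) \<bullet> (y - z)"
      by (simp add: inner_diff_right inner_diff_left inner_add_right power_mult_distrib)
    then show ?thesis
      unfolding D2 D_def[symmetric] by (simp add: algebra_simps)
  qed
  show ?thesis
  proof (cases "K = 0")
    case True
    \<comment> \<open>For \<open>K = 0\<close> the bound is linear in \<open>t\<close>, so a large \<open>t\<close> refutes \<open>D \<noteq> 0\<close>.\<close>
    have "D = 0"
    proof (rule ccontr)
      assume "D \<noteq> 0"
      then have "(norm D)\<^sup>2 \<noteq> 0" by simp
      then have "2 * ((D \<bullet> (y - z) + 1) / (2 * (norm D)\<^sup>2)) * (norm D)\<^sup>2 = D \<bullet> (y - z) + 1"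
        by (simp add: field_simps)
      then show False
        using trial[of "(D \<bullet> (y - z) + 1) / (2 * (norm D)\<^sup>2)"] True by simp
    qed
    then show ?thesis using True by (simp add: D_def)
  next
    case False
    then have "0 < K" using K by simp
    have "2 * (1 / K) - K * (1 / K)\<^sup>2 = 1 / K"
      using False by (simp add: power2_eq_square field_simps)
    then have "1 / K * (norm D)\<^sup>2 \<le> D \<bullet> (y - z)"
      using trial[of "1 / K"] by simp
    then show ?thesis
      using \<open>0 < K\<close> by (simp add: D_def field_simps)
  qed
qed

lemma cocoercive_imp_lipschitz:
  fixes g d :: "'v::real_inner"
  assumes coco: "(norm g)\<^sup>2 \<le> K * (g \<bullet> d)" and K: "0 \<le> K"
  shows "norm g \<le> K * norm d"
proof (cases "g = 0")
  case True
  then show ?thesis using K by simp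
next
  case False
  have "norm g * norm g \<le> K * (norm g * norm d)"
    using coco mult_left_mono[OF norm_cauchy_schwarz[of g d] K] by (simp add: power2_eq_square)
  then have "norm g * norm g \<le> norm g * (K * norm d)" by (simp add: mult_ac)
  then show ?thesis using False by simp
qed

lemma GDERIV_line:
  assumes "\<And>y. GDERIV F y :> G y"
  shows "DERIV (\<lambda>t. F (y + t *\<^sub>R d)) t :> G (y + t *\<^sub>R d) \<bullet> d"
proof -
  have F: "(F has_derivative (\<lambda>h. h \<bullet> G (y + t *\<^sub>R d))) (at (y + t *\<^sub>R d))"
    using assms unfolding gderiv_def .
  have "((\<lambda>t. y + t *\<^sub>R d) has_derivative (\<lambda>s. s *\<^sub>R d)) (at t)"
    by (auto intro!: derivative_eq_intros)
  from has_derivative_compose[OF this F] show ?thesis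
    by (simp add: has_field_derivative_def inner_commute mult_commute_abs)
qed

text \<open>The gap between the two sides, as a function on the segment from \<open>y\<close> to \<open>z\<close>,
  vanishes at \<open>y\<close> and is monotone by the Cauchy-Schwarz inequality and the Lipschitz condition.\<close>

lemma lipschitz_gradient_upper_bound:
  assumes deriv: "\<And>y. GDERIV F y :> G y"
    and lip: "\<And>y z. norm (G y - G z) \<le> K * norm (y - z)"
  shows "F z \<le> F y + G y \<bullet> (z - y) + K / 2 * (norm (z - y))\<^sup>2"
proof -
  define d where "d = z - y"
  let ?h = "\<lambda>t. F (y + t *\<^sub>R d) - t * (G y \<bullet> d) - K / 2 * t\<^sup>2 * (norm d)\<^sup>2"
  have "?h 1 \<le> ?h 0"
  proof (rule DERIV_nonpos_imp_nonincreasing[where f = ?h])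
    fix t :: real assume t: "0 \<le> t" "t \<le> 1"
    have "DERIV ?h t :> G (y + t *\<^sub>R d) \<bullet> d - G y \<bullet> d - K * t * (norm d)\<^sup>2"
      by (auto intro!: derivative_eq_intros GDERIV_line deriv)
    moreover have "(G (y + t *\<^sub>R d) - G y) \<bullet> d \<le> K * t * (norm d)\<^sup>2"
    proof -
      have "(G (y + t *\<^sub>R d) - G y) \<bullet> d \<le> norm (G (y + t *\<^sub>R d) - G y) * norm d"
        by (rule norm_cauchy_schwarz)
      also have "\<dots> \<le> (K * norm ((y + t *\<^sub>R d) - y)) * norm d"
        by (rule mult_right_mono[OF lip]) simp
      finally show ?thesis using t by (simp add: power2_eq_square mult_ac)
    qed
    ultimately show "\<exists>D. DERIV ?h t :> D \<and> D \<le> 0"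
      by (auto simp: inner_diff_left)
  qed simp
  then show ?thesis by (simp add: d_def)
qed

text \<open>Dividing the strong convexity inequality by the weight \<open>t\<close> of \<open>z\<close> turns the left side
  into a difference quotient, and \<open>t\<close> tends to 0 from the right.\<close>

lemma strongly_convex_lower_bound:
  assumes deriv: "\<And>y. GDERIV F y :> G y"
    and strong: "strongly_convex \<mu> F"
  shows "F y + G y \<bullet> (z - y) + \<mu> / 2 * (norm (z - y))\<^sup>2 \<le> F z"
proof -
  define d where "d = z - y"
  have "((\<lambda>t. (F (y + t *\<^sub>R d) - F y) / t) \<longlongrightarrow> G y \<bullet> d) (at 0)"
    using GDERIV_line[OF deriv, of y d 0] by (simp add: DERIV_def)
  then have lim: "((\<lambda>t. (F (y + t *\<^sub>R d) - F y) / t + \<mu> / 2 * (1 - t) * (norm d)\<^sup>2)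
      \<longlongrightarrow> G y \<bullet> d + \<mu> / 2 * (1 - 0) * (norm d)\<^sup>2) (at_right 0)"
    by (intro tendsto_intros) (auto intro: tendsto_mono[rotated] simp: at_within_le_at)
  have "eventually (\<lambda>t::real. 0 < t \<and> t < 1) (at_right 0)"
    by (auto simp: eventually_at_right_field intro: exI[of _ 1])
  then have "eventually (\<lambda>t. (F (y + t *\<^sub>R d) - F y) / t + \<mu> / 2 * (1 - t) * (norm d)\<^sup>2 \<le> F z - F y)
      (at_right 0)"
  proof eventually_elim
    case (elim t)
    have "F (t *\<^sub>R z + (1 - t) *\<^sub>R y) \<le> t * F z + (1 - t) * F y - \<mu> / 2 * t * (1 - t) * (norm (z - y))\<^sup>2"
      using strong elim unfolding strongly_convex_def by auto
    moreover have "t *\<^sub>R z + (1 - t) *\<^sub>R y = y + t *\<^sub>R d"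
      by (simp add: d_def algebra_simps)
    ultimately have "F (y + t *\<^sub>R d) - F y \<le> t * (F z - F y - \<mu> / 2 * (1 - t) * (norm d)\<^sup>2)"
      by (simp add: d_def algebra_simps)
    then have "(F (y + t *\<^sub>R d) - F y) / t \<le> F z - F y - \<mu> / 2 * (1 - t) * (norm d)\<^sup>2"
      using elim by (simp add: divide_le_eq mult.commute)
    then show ?case by simp
  qed
  from tendsto_upperbound[OF lim this] show ?thesis
    by (simp add: d_def)
qed

text \<open>Subtracting \<open>\<mu> / 2 \<parallel>y\<parallel>\<^sup>2\<close> from the function leaves a convex function whose quadratic upper
  bound has constant \<open>K - \<mu>\<close>; its cocoercivity, expanded, is the claim.\<close>

lemma strongly_convex_smooth_monotone:
  fixes F :: "'v::real_inner \<Rightarrow> real" and G :: "'v \<Rightarrow> 'v"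
  assumes lower: "\<And>y z. F y + G y \<bullet> (z - y) + \<mu> / 2 * (norm (z - y))\<^sup>2 \<le> F z"
    and upper: "\<And>y z. F z \<le> F y + G y \<bullet> (z - y) + K / 2 * (norm (z - y))\<^sup>2"
    and le: "\<mu> \<le> K"
  shows "\<mu> * K * (norm (y - z))\<^sup>2 + (norm (G y - G z))\<^sup>2 \<le> (\<mu> + K) * ((G y - G z) \<bullet> (y - z))"
proof -
  let ?f = "\<lambda>y. F y - \<mu> / 2 * (norm y)\<^sup>2" and ?G = "\<lambda>y. G y - \<mu> *\<^sub>R y"
  have sq: "(norm z)\<^sup>2 = (norm y)\<^sup>2 + 2 * (y \<bullet> (z - y)) + (norm (z - y))\<^sup>2" for y z :: 'v
    by (simp add: power2_norm_eq_inner inner_diff inner_commute)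
  have coco: "(norm (?G y - ?G z))\<^sup>2 \<le> (K - \<mu>) * ((?G y - ?G z) \<bullet> (y - z))"
  proof (rule convex_smooth_cocoercive[of ?f])
    show "?f y + ?G y \<bullet> (z - y) \<le> ?f z" for y z
      using lower[of y z] unfolding sq[of z y] by (simp add: inner_diff_left algebra_simps)
    show "?f z \<le> ?f y + ?G y \<bullet> (z - y) + (K - \<mu>) / 2 * (norm (z - y))\<^sup>2" for y z
      using upper[of z y] unfolding sq[of z y]
      by (simp add: inner_diff_left left_diff_distrib diff_divide_distrib distrib_left)
    show "0 \<le> K - \<mu>" using le by simp
  qed
  define g d where "g = G y - G z" and "d = y - z"
  have "?G y - ?G z = g - \<mu> *\<^sub>R d"
    by (simp add: g_def d_def algebra_simps)
  with coco have "(norm (g - \<mu> *\<^sub>R d))\<^sup>2 \<le> (K - \<mu>) * ((g - \<mu> *\<^sub>R d) \<bullet> d)"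
    by (simp add: d_def)
  also have "(g - \<mu> *\<^sub>R d) \<bullet> d = g \<bullet> d - \<mu> * (norm d)\<^sup>2"
    by (simp add: inner_diff_left power2_norm_eq_inner)
  finally have "\<mu> * K * (norm d)\<^sup>2 + (norm g)\<^sup>2 \<le> (\<mu> + K) * (g \<bullet> d)"
    unfolding norm_sq_diff_scaleR by (simp add: inner_commute power2_eq_square[of \<mu>] algebra_simps)
  then show ?thesis by (simp only: g_def d_def)
qed

section \<open>Sums of gradients with few conflicts\<close>

lemma disjoint_supp_inner:
  fixes u v :: "real ^ 'd"
  assumes "supp u \<inter> supp v = {}"
  shows "u \<bullet> v = 0"
  using assms unfolding inner_vec_def supp_def by (intro sum.neutral) auto

text \<open>In the expansion of the square into inner products, row \<open>i\<close> has at most one nonzero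
  diagonal entry and one entry for each conflict of \<open>i\<close>, each of size at most \<open>c\<^sup>2\<close>.\<close>

lemma norm_sum_supp_le:
  fixes a v :: "nat \<Rightarrow> real ^ 'd"
  assumes sub: "\<And>i. i \<in> {1..m} \<Longrightarrow> supp (v i) \<subseteq> supp (a i)"
    and bound: "\<And>i. i \<in> {1..m} \<Longrightarrow> norm (v i) \<le> c" and c: "0 \<le> c"
  shows "(norm (\<Sum>i=1..m. v i))\<^sup>2 \<le> c\<^sup>2 * (real m * (1 + Delta_ave m a))"
proof -
  have "(norm (\<Sum>i=1..m. v i))\<^sup>2 = (\<Sum>i=1..m. \<Sum>j=1..m. v i \<bullet> v j)"
    by (simp add: power2_norm_eq_inner inner_sum_left inner_sum_right) (rule sum.swap)
  also have "\<dots> \<le> (\<Sum>i=1..m. c\<^sup>2 * (1 + conflict_degree m a i))"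
  proof (rule sum_mono)
    fix i assume i: "i \<in> {1..m}"
    have prod: "v i \<bullet> v j \<le> c\<^sup>2" if "j \<in> {1..m}" for j
      using norm_cauchy_schwarz[of "v i" "v j"] mult_mono[OF bound[OF i] bound[OF that] c norm_ge_zero]
      by (simp add: power2_eq_square)
    have "(\<Sum>j=1..m. v i \<bullet> v j) = v i \<bullet> v i + (\<Sum>j\<in>{1..m} - {i}. v i \<bullet> v j)"
      using i by (simp add: sum.remove)
    also have "\<dots> \<le> c\<^sup>2 + (\<Sum>j\<in>{1..m} - {i}. c\<^sup>2 * of_bool (supp (a i) \<inter> supp (a j) \<noteq> {}))"
    proof (intro add_mono sum_mono)
      show "v i \<bullet> v i \<le> c\<^sup>2" by (rule prod[OF i])
      fix j assume j: "j \<in> {1..m} - {i}"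
      show "v i \<bullet> v j \<le> c\<^sup>2 * of_bool (supp (a i) \<inter> supp (a j) \<noteq> {})"
      proof (cases "supp (a i) \<inter> supp (a j) = {}")
        case True
        then have "supp (v i) \<inter> supp (v j) = {}" using sub[of i] sub[of j] i j by blast
        then show ?thesis using True disjoint_supp_inner by fastforce
      next
        case False
        then show ?thesis using prod[of j] j by simp
      qed
    qed
    also have "\<dots> = c\<^sup>2 * (1 + conflict_degree m a i)"
      by (simp only: conflict_degree_def distrib_left sum_distrib_left mult_1_right)
    finally show "(\<Sum>j=1..m. v i \<bullet> v j) \<le> c\<^sup>2 * (1 + conflict_degree m a i)" .
  qed
  also have "\<dots> = c\<^sup>2 * (real m + (\<Sum>i=1..m. conflict_degree m a i))"
    by (simp add: sum_distrib_left[symmetric] sum.distrib)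
  also have "real m + (\<Sum>i=1..m. conflict_degree m a i) = real m * (1 + Delta_ave m a)"
    by (cases "m = 0") (simp_all add: Delta_ave_def distrib_left)
  finally show ?thesis .
qed

lemma supp_diff_subset: "supp (u - v) \<subseteq> supp u \<union> supp v"
  unfolding supp_def by auto

lemma Delta_ave_nonneg: "0 \<le> Delta_ave m a"
  unfolding Delta_ave_def conflict_degree_def by (intro mult_nonneg_nonneg sum_nonneg) auto

lemma Delta_ave_le_max:
  assumes "m > 0"
  shows "Delta_ave m a \<le> Delta_max m a"
proof -
  have "(\<Sum>i=1..m. conflict_degree m a i) \<le> (\<Sum>i=1..m. Delta_max m a)"
    unfolding Delta_max_def by (intro sum_mono Max_ge) auto
  then show ?thesis
    using assms by (simp add: Delta_ave_def field_simps)
qed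

text \<open>Cocoercivity bounds the variation of each summand's gradient by \<open>L \<parallel>y - z\<parallel>\<close>. The variations
  inherit the supports of the gradients, so only conflicting pairs of them interact.\<close>

lemma lipschitz_sum_gradients:
  fixes a :: "nat \<Rightarrow> real ^ 'd" and f :: "nat \<Rightarrow> real ^ 'd \<Rightarrow> real" and g :: "nat \<Rightarrow> real ^ 'd \<Rightarrow> real ^ 'd"
  assumes lower: "\<And>i y z. i \<in> {1..m} \<Longrightarrow> f i y + g i y \<bullet> (z - y) \<le> f i z"
    and upper: "\<And>i y z. i \<in> {1..m} \<Longrightarrow>
          f i z \<le> f i y + g i y \<bullet> (z - y) + L / 2 * (norm (z - y))\<^sup>2"
    and supp: "\<And>i y. i \<in> {1..m} \<Longrightarrow> supp (g i y) \<subseteq> supp (a i)"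
    and L: "0 \<le> L"
  shows "norm ((\<Sum>i=1..m. g i y) - (\<Sum>i=1..m. g i z))
           \<le> L * sqrt (real m * (1 + Delta_ave m a)) * norm (y - z)"
proof -
  define v where "v i = g i y - g i z" for i
  let ?S = "real m * (1 + Delta_ave m a)"
  have S: "0 \<le> ?S"
    using Delta_ave_nonneg[of m a] by simp
  have v_supp: "supp (v i) \<subseteq> supp (a i)" if "i \<in> {1..m}" for i
    using supp_diff_subset[of "g i y" "g i z"] supp[OF that, of y] supp[OF that, of z]
    unfolding v_def by blast
  have v_norm: "norm (v i) \<le> L * norm (y - z)" if i: "i \<in> {1..m}" for i
    unfolding v_def
    by (rule cocoercive_imp_lipschitz[OF convex_smooth_cocoercive[OF lower[OF i] upper[OF i] L] L])
  have "(norm (\<Sum>i=1..m. v i))\<^sup>2 \<le> (L * norm (y - z))\<^sup>2 * ?S"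
    by (rule norm_sum_supp_le[OF v_supp v_norm]) (use L in simp_all)
  also have "\<dots> = (L * sqrt ?S * norm (y - z))\<^sup>2"
    unfolding power_mult_distrib real_sqrt_pow2[OF S] by simp
  finally have "norm (\<Sum>i=1..m. v i) \<le> L * sqrt ?S * norm (y - z)"
    by (rule power2_le_imp_le) (intro mult_nonneg_nonneg real_sqrt_ge_zero L S norm_ge_zero)
  then show ?thesis
    by (simp only: v_def sum_subtractf)
qed

section \<open>One quantized gradient step\<close>

lemma quantized_step_second_moment:
  assumes urq: "unbiased_random_quantizer N Q \<alpha>"
  shows "integrable N (\<lambda>s. (norm (u - c *\<^sub>R Q s v))\<^sup>2)"
    and "(\<integral>s. (norm (u - c *\<^sub>R Q s v))\<^sup>2 \<partial>N)
           \<le> (norm u)\<^sup>2 - 2 * c * (v \<bullet> u) + c\<^sup>2 * (\<alpha> * (norm v)\<^sup>2)"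
proof -
  interpret N: prob_space N using urq by (simp add: unbiased_random_quantizer_def)
  have Q: "integrable N (\<lambda>s. Q s v)" "(\<integral>s. Q s v \<partial>N) = v"
    and Q2: "integrable N (\<lambda>s. (norm (Q s v))\<^sup>2)" "(\<integral>s. (norm (Q s v))\<^sup>2 \<partial>N) \<le> \<alpha> * (norm v)\<^sup>2"
    using urq by (simp_all add: unbiased_random_quantizer_def)
  have int: "integrable N (\<lambda>s. (norm u)\<^sup>2)" "integrable N (\<lambda>s. 2 * c * (Q s v \<bullet> u))"
    "integrable N (\<lambda>s. c\<^sup>2 * (norm (Q s v))\<^sup>2)"
    using Q Q2 by simp_all
  show "integrable N (\<lambda>s. (norm (u - c *\<^sub>R Q s v))\<^sup>2)"
    unfolding norm_sq_diff_scaleR by (intro Bochner_Integration.integrable_add Bochner_Integration.integrable_diff int)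
  have "(\<integral>s. (norm (u - c *\<^sub>R Q s v))\<^sup>2 \<partial>N)
      = (norm u)\<^sup>2 - 2 * c * (v \<bullet> u) + c\<^sup>2 * (\<integral>s. (norm (Q s v))\<^sup>2 \<partial>N)"
    unfolding norm_sq_diff_scaleR using int Q Q2 by (simp add: N.prob_space)
  then show "(\<integral>s. (norm (u - c *\<^sub>R Q s v))\<^sup>2 \<partial>N)
      \<le> (norm u)\<^sup>2 - 2 * c * (v \<bullet> u) + c\<^sup>2 * (\<alpha> * (norm v)\<^sup>2)"
    using mult_left_mono[OF Q2(2), of "c\<^sup>2"] by simp
qed

text \<open>With step size \<open>c\<close> the choice \<open>c \<alpha> = 2 / (\<mu> + K)\<close> makes the second-moment term
  \<open>c\<^sup>2 \<alpha> \<parallel>v\<parallel>\<^sup>2\<close> equal to the \<open>\<parallel>v\<parallel>\<^sup>2\<close> term that \<open>mono\<close> gains from the inner product.\<close>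

lemma quantized_step_contraction:
  assumes urq: "unbiased_random_quantizer N Q \<alpha>"
    and pos: "0 < \<mu> + K"
    and mono: "\<mu> * K * (norm u)\<^sup>2 + (norm v)\<^sup>2 \<le> (\<mu> + K) * (v \<bullet> u)"
  shows "(\<integral>s. (norm (u - (1 / \<alpha> * (2 / (\<mu> + K))) *\<^sub>R Q s v))\<^sup>2 \<partial>N)
           \<le> (1 - 1 / \<alpha> * (4 * \<mu> * K / (\<mu> + K)\<^sup>2)) * (norm u)\<^sup>2"
proof -
  define S where "S = \<mu> + K"
  define c where "c = 1 / \<alpha> * (2 / S)"
  have \<alpha>: "0 < \<alpha>" using urq by (simp add: unbiased_random_quantizer_def)
  have S: "0 < S" using pos by (simp add: S_def)
  have c: "0 < c" "c * \<alpha> = 2 / S" using \<alpha> S by (simp_all add: c_def)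
  have "\<mu> * K * (norm u)\<^sup>2 + (norm v)\<^sup>2 \<le> S * (v \<bullet> u)"
    using mono by (simp add: S_def)
  then have "(\<mu> * K * (norm u)\<^sup>2 + (norm v)\<^sup>2) / S \<le> v \<bullet> u"
    using S by (simp add: divide_le_eq mult.commute)
  from mult_left_mono[OF this, of "2 * c"]
  have "2 * c * ((\<mu> * K * (norm u)\<^sup>2 + (norm v)\<^sup>2) / S) \<le> 2 * c * (v \<bullet> u)" using c by simp
  moreover have "c\<^sup>2 * (\<alpha> * (norm v)\<^sup>2) = 2 * c * ((norm v)\<^sup>2 / S)"
  proof -
    have "c\<^sup>2 * (\<alpha> * (norm v)\<^sup>2) = c * (c * \<alpha>) * (norm v)\<^sup>2" by (simp add: power2_eq_square)
    then show ?thesis by (simp add: c)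
  qed
  moreover have "2 * c * (\<mu> * K * (norm u)\<^sup>2 / S) = 1 / \<alpha> * (4 * \<mu> * K / S\<^sup>2) * (norm u)\<^sup>2"
    by (simp add: c_def power2_eq_square)
  ultimately have "(norm u)\<^sup>2 - 2 * c * (v \<bullet> u) + c\<^sup>2 * (\<alpha> * (norm v)\<^sup>2)
      \<le> (1 - 1 / \<alpha> * (4 * \<mu> * K / S\<^sup>2)) * (norm u)\<^sup>2"
    by (simp add: add_divide_distrib distrib_left left_diff_distrib)
  with quantized_step_second_moment(2)[OF urq, of u c v] show ?thesis
    unfolding c_def S_def by linarith
qed

section \<open>Fresh seeds\<close>

text \<open>Independence makes the joint distribution a product measure, to which Tonelli's theorem
  applies.\<close>

lemma (in prob_space) nn_integral_indep_var:
  assumes indep: "indep_var S X T Y" and g: "case_prod g \<in> borel_measurable (S \<Otimes>\<^sub>M T)"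
  shows "(\<integral>\<^sup>+w. g (X w) (Y w) \<partial>M) = (\<integral>\<^sup>+w. (\<integral>\<^sup>+y. g (X w) y \<partial>distr M T Y) \<partial>M)"
proof -
  have X[measurable]: "X \<in> measurable M S" and Y[measurable]: "Y \<in> measurable M T"
    and eq: "distr M S X \<Otimes>\<^sub>M distr M T Y = distr M (S \<Otimes>\<^sub>M T) (\<lambda>w. (X w, Y w))"
    using indep unfolding indep_var_distribution_eq by auto
  interpret Y: prob_space "distr M T Y" by (rule prob_space_distr) fact
  have [measurable_cong]: "sets (distr M T Y) = sets T" by simp
  note g[measurable]
  have "(\<integral>\<^sup>+w. g (X w) (Y w) \<partial>M) = (\<integral>\<^sup>+p. case_prod g p \<partial>distr M (S \<Otimes>\<^sub>M T) (\<lambda>w. (X w, Y w)))"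
    by (subst nn_integral_distr) simp_all
  also have "\<dots> = (\<integral>\<^sup>+p. case_prod g p \<partial>(distr M S X \<Otimes>\<^sub>M distr M T Y))"
    by (simp add: eq)
  also have "\<dots> = (\<integral>\<^sup>+x. (\<integral>\<^sup>+y. g x y \<partial>distr M T Y) \<partial>distr M S X)"
    by (subst Y.nn_integral_fst[symmetric]) simp_all
  also have "\<dots> = (\<integral>\<^sup>+w. (\<integral>\<^sup>+y. g (X w) y \<partial>distr M T Y) \<partial>M)"
    by (rule nn_integral_distr) measurable
  finally show ?thesis .
qed

text \<open>The index set \<open>{..<k}\<close> records that the state at time \<open>k\<close> has not yet seen the seed
  \<open>\<xi> k\<close>, which makes it independent of that seed.\<close>

lemma recursion_function_of_past:
  assumes init: "\<And>w. w \<in> W \<Longrightarrow> x 0 w = x0"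
    and iter: "\<And>k w. w \<in> W \<Longrightarrow> x (Suc k) w = T (\<xi> k w) (x k w)"
    and x0: "x0 \<in> space R"
    and T: "case_prod T \<in> measurable (N \<Otimes>\<^sub>M R) R"
  shows "\<exists>h \<in> measurable (\<Pi>\<^sub>M i\<in>{..<k}. N) R. \<forall>w\<in>W. x k w = h (\<lambda>i\<in>{..<k}. \<xi> i w)"
proof (induction k)
  case 0
  show ?case
    using x0 init by (intro bexI[of _ "\<lambda>_. x0"]) auto
next
  case (Suc k)
  then obtain h where h[measurable]: "h \<in> measurable (\<Pi>\<^sub>M i\<in>{..<k}. N) R"
    and hx: "\<And>w. w \<in> W \<Longrightarrow> x k w = h (\<lambda>i\<in>{..<k}. \<xi> i w)" by blast
  note T[measurable]
  let ?h = "\<lambda>u. case_prod T (u k, h (restrict u {..<k}))"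
  have [measurable]: "(\<lambda>u. u k) \<in> measurable (\<Pi>\<^sub>M i\<in>{..<Suc k}. N) N"
    by (rule measurable_component_singleton) simp
  have [measurable]: "(\<lambda>u. restrict u {..<k}) \<in> measurable (\<Pi>\<^sub>M i\<in>{..<Suc k}. N) (\<Pi>\<^sub>M i\<in>{..<k}. N)"
    by (rule measurable_restrict_subset) auto
  have "?h \<in> measurable (\<Pi>\<^sub>M i\<in>{..<Suc k}. N) R"
    by measurable
  moreover have "x (Suc k) w = ?h (\<lambda>i\<in>{..<Suc k}. \<xi> i w)" if "w \<in> W" for w
  proof -
    have "restrict (\<lambda>i\<in>{..<Suc k}. \<xi> i w) {..<k} = (\<lambda>i\<in>{..<k}. \<xi> i w)"
      by (auto simp: restrict_def fun_eq_iff)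
    then show ?thesis using that by (simp add: iter hx)
  qed
  ultimately show ?case by (intro bexI[of _ ?h] ballI)
qed

text \<open>The analogue of conditioning on the past. Independence is obtained for the families of
  seeds indexed by \<open>{..<k}\<close> and by \<open>{k}\<close>, and then transported to the state and the seed,
  because \<open>indep_var\<close> relates only random variables with values in the same type, and states and
  seeds have different types.\<close>

lemma
  assumes fresh: "fresh_seeds M N \<xi>"
    and init: "\<And>w. w \<in> space M \<Longrightarrow> x 0 w = x0"
    and iter: "\<And>k w. w \<in> space M \<Longrightarrow> x (Suc k) w = T (\<xi> k w) (x k w)"
    and x0: "x0 \<in> space R"
    and T: "case_prod T \<in> measurable (N \<Otimes>\<^sub>M R) R"
  shows measurable_recursion: "x k \<in> measurable M R"
    and nn_integral_fresh_seed: "case_prod g \<in> borel_measurable (R \<Otimes>\<^sub>M N) \<Longrightarrow>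
          (\<integral>\<^sup>+w. g (x k w) (\<xi> k w) \<partial>M) = (\<integral>\<^sup>+w. (\<integral>\<^sup>+s. g (x k w) s \<partial>N) \<partial>M)"
proof -
  interpret prob_space M using fresh by (simp add: fresh_seeds_def)
  have indep: "indep_vars (\<lambda>_. N) \<xi> UNIV" and distr: "distr M N (\<xi> k) = N"
    using fresh by (simp_all add: fresh_seeds_def)
  have \<xi>: "random_variable N (\<xi> k)"
    using indep by (simp add: indep_vars_def)
  obtain h where h[measurable]: "h \<in> measurable (\<Pi>\<^sub>M i\<in>{..<k}. N) R"
    and hx: "\<And>w. w \<in> space M \<Longrightarrow> x k w = h (\<lambda>i\<in>{..<k}. \<xi> i w)"
    using recursion_function_of_past[where W = "space M" and x = x, OF init iter x0 T, of k] by blast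
  define U where "U w = (\<lambda>i\<in>{..<k}. \<xi> i w)" for w
  define Z where "Z w = (\<lambda>i\<in>{k}. \<xi> i w)" for w
  have UZ: "indep_var (\<Pi>\<^sub>M i\<in>{..<k}. N) U (\<Pi>\<^sub>M i\<in>{k}. N) Z"
    unfolding U_def Z_def by (rule indep_var_restrict[OF indep]) auto
  have U: "random_variable (\<Pi>\<^sub>M i\<in>{..<k}. N) U" and Z: "random_variable (\<Pi>\<^sub>M i\<in>{k}. N) Z"
    using UZ by (blast dest: indep_var_rv1 indep_var_rv2)+
  have hU: "(\<lambda>w. h (U w)) \<in> measurable M R"
    using U h by (rule measurable_compose)
  have x_eq: "x k w = h (U w)" if "w \<in> space M" for w
    using hx[OF that] by (simp only: U_def)
  have "x k \<in> measurable M R \<longleftrightarrow> (\<lambda>w. h (U w)) \<in> measurable M R"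
    by (rule measurable_cong) (rule x_eq)
  with hU show meas: "x k \<in> measurable M R" by blast

  assume g: "case_prod g \<in> borel_measurable (R \<Otimes>\<^sub>M N)"
  have comp: "(\<lambda>v. v k) \<in> measurable (\<Pi>\<^sub>M i\<in>{k}. N) N"
    by (rule measurable_component_singleton) simp
  have "(\<lambda>p. case_prod g (h (fst p), snd p k)) \<in> borel_measurable ((\<Pi>\<^sub>M i\<in>{..<k}. N) \<Otimes>\<^sub>M (\<Pi>\<^sub>M i\<in>{k}. N))"
    by (rule measurable_compose[OF measurable_Pair g])
      (rule measurable_compose[OF measurable_fst h] measurable_compose[OF measurable_snd comp])+
  then have g': "case_prod (\<lambda>u v. g (h u) (v k)) \<in> borel_measurable ((\<Pi>\<^sub>M i\<in>{..<k}. N) \<Otimes>\<^sub>M (\<Pi>\<^sub>M i\<in>{k}. N))"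
    by (simp only: case_prod_unfold fst_conv snd_conv)
  have "(\<integral>\<^sup>+w. g (x k w) (\<xi> k w) \<partial>M) = (\<integral>\<^sup>+w. g (h (U w)) (Z w k) \<partial>M)"
    by (rule nn_integral_cong) (simp add: x_eq Z_def)
  also have "\<dots> = (\<integral>\<^sup>+w. (\<integral>\<^sup>+v. g (h (U w)) (v k) \<partial>distr M (\<Pi>\<^sub>M i\<in>{k}. N) Z) \<partial>M)"
    by (rule nn_integral_indep_var[OF UZ g'])
  also have "\<dots> = (\<integral>\<^sup>+w. (\<integral>\<^sup>+s. g (x k w) s \<partial>N) \<partial>M)"
  proof (rule nn_integral_cong)
    fix w assume w: "w \<in> space M"
    have "h (U w) \<in> space R"
      using measurable_space[OF hU w] .
    from measurable_Pair2[OF g this] have gw: "g (h (U w)) \<in> borel_measurable N"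
      by simp
    have "(\<integral>\<^sup>+v. g (h (U w)) (v k) \<partial>distr M (\<Pi>\<^sub>M i\<in>{k}. N) Z) = (\<integral>\<^sup>+w'. g (h (U w)) (Z w' k) \<partial>M)"
      by (rule nn_integral_distr[OF Z]) (simp only: measurable_distr_eq1 measurable_compose[OF comp gw])
    also have "\<dots> = (\<integral>\<^sup>+s. g (h (U w)) s \<partial>distr M N (\<xi> k))"
      using gw by (subst nn_integral_distr[OF \<xi>]) (simp_all add: Z_def)
    finally show "(\<integral>\<^sup>+v. g (h (U w)) (v k) \<partial>distr M (\<Pi>\<^sub>M i\<in>{k}. N) Z) = (\<integral>\<^sup>+s. g (x k w) s \<partial>N)"
      by (simp only: distr x_eq[OF w])
  qed
  finally show "(\<integral>\<^sup>+w. g (x k w) (\<xi> k w) \<partial>M) = (\<integral>\<^sup>+w. (\<integral>\<^sup>+s. g (x k w) s \<partial>N) \<partial>M)" .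
qed

section \<open>Convergence of quantized gradient descent\<close>

theorem theorem4p1:
  fixes m :: nat
    and f :: "nat \<Rightarrow> real ^ 'd \<Rightarrow> real"
    and F :: "real ^ 'd \<Rightarrow> real"
    and loss :: "real \<Rightarrow> real \<Rightarrow> real"
    and a :: "nat \<Rightarrow> real ^ 'd"
    and b :: "nat \<Rightarrow> real"
    and L \<mu> \<alpha> \<Delta> Lbar \<rho> :: real
    and \<gamma> :: "nat \<Rightarrow> real"
    and N :: "'s measure"
    and Q :: "'s \<Rightarrow> real ^ 'd \<Rightarrow> real ^ 'd"
    and M :: "'w measure"
    and \<xi> :: "nat \<Rightarrow> 'w \<Rightarrow> 's"
    and x :: "nat \<Rightarrow> 'w \<Rightarrow> real ^ 'd"
    and x0 xstar :: "real ^ 'd"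
  assumes F_def: "F = (\<lambda>y. \<Sum>i=1..m. f i y)"
    and diff: "\<And>i y. i \<in> {1..m} \<Longrightarrow> f i differentiable (at y)"
    and convex: "\<And>i y z. i \<in> {1..m} \<Longrightarrow> f i y + grad (f i) y \<bullet> (z - y) \<le> f i z"
    and smooth: "\<And>i y z. i \<in> {1..m} \<Longrightarrow>
          f i z \<le> f i y + grad (f i) y \<bullet> (z - y) + L / 2 * (norm (z - y))\<^sup>2"
    and mu_pos: "\<mu> > 0"
    and strong: "strongly_convex \<mu> F"
    and model: "\<And>i y. i \<in> {1..m} \<Longrightarrow> f i y = loss (a i \<bullet> y) (b i)"
    and supp_grad: "\<And>i y. i \<in> {1..m} \<Longrightarrow> supp (grad (f i) y) = supp (a i)"
    and Delta: "\<Delta> = min (Delta_ave m a) (Delta_max m a)"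
    and Lbar: "Lbar = L * sqrt (real m * (1 + \<Delta>))"
    and minimizer: "\<And>y. F xstar \<le> F y"
    and urq: "unbiased_random_quantizer N Q \<alpha>"
    and fresh: "fresh_seeds M N \<xi>"
    and step: "\<And>k. \<gamma> k = 1 / \<alpha> * (2 / (\<mu> + Lbar))"
    and init: "\<And>w. w \<in> space M \<Longrightarrow> x 0 w = x0"
    and iter: "\<And>k w. w \<in> space M \<Longrightarrow>
          x (Suc k) w = x k w - \<gamma> k *\<^sub>R Q (\<xi> k w) (grad F (x k w))"
    and rho: "\<rho> = 1 - 1 / \<alpha> * (4 * \<mu> * Lbar / (\<mu> + Lbar)\<^sup>2)"
  shows "\<forall>k. integrable M (\<lambda>w. (norm (x k w - xstar))\<^sup>2) \<and>
             (\<integral>w. (norm (x k w - xstar))\<^sup>2 \<partial>M) \<le> \<rho> ^ k * (norm (x0 - xstar))\<^sup>2"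
proof -
  interpret M: prob_space M using fresh by (simp add: fresh_seeds_def)
  define G where "G y = (\<Sum>i=1..m. grad (f i) y)" for y
  define c where "c = 1 / \<alpha> * (2 / (\<mu> + Lbar))"
  define V where "V k w = ennreal ((norm (x k w - xstar))\<^sup>2)" for k w

  have deriv: "GDERIV F y :> G y" for y
    unfolding F_def G_def gderiv_def inner_sum_right
    by (intro has_derivative_sum) (use GDERIV_grad[OF diff] in \<open>auto simp: gderiv_def\<close>)
  have gradF: "grad F y = G y" for y
    using deriv by (rule grad_eqI)
  note lower = strongly_convex_lower_bound[OF deriv strong]

  \<comment> \<open>Along a unit displacement, inequalities between quadratic bounds become inequalities
    between their constants.\<close>
  obtain e :: "real ^ 'd" where e: "norm e = 1"
    using vector_choose_size[of 1] by auto
  have m: "m > 0"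
  proof (rule ccontr)
    assume "\<not> m > 0"
    then have "F = (\<lambda>y. 0)" "G = (\<lambda>y. 0)" by (simp_all add: F_def G_def fun_eq_iff)
    then show False using lower[of 0 e] e mu_pos by simp
  qed
  have L: "0 \<le> L"
  proof -
    have "1 \<in> {1..m}" using m by simp
    from convex[OF this, of 0 e] smooth[OF this, of e 0] show ?thesis using e by simp
  qed
  have \<Delta>: "\<Delta> = Delta_ave m a"
    unfolding Delta by (rule min_absorb1[OF Delta_ave_le_max[OF m]])
  have lip: "norm (G y - G z) \<le> Lbar * norm (y - z)" for y z
    unfolding G_def Lbar \<Delta>
    by (rule lipschitz_sum_gradients[OF convex smooth equalityD1[OF supp_grad] L])
  note upper = lipschitz_gradient_upper_bound[OF deriv lip]
  have le: "\<mu> \<le> Lbar"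
    using lower[of 0 e] upper[of e 0] e by simp
  have Gstar: "G xstar = 0"
  proof -
    have "(\<lambda>h. h \<bullet> G xstar) = (\<lambda>h. 0)"
      by (rule has_derivative_local_min[OF deriv[unfolded gderiv_def]]) (simp add: minimizer)
    then show ?thesis by (metis inner_eq_zero_iff)
  qed
  have contr: "(\<integral>s. (norm ((y - xstar) - c *\<^sub>R Q s (G y)))\<^sup>2 \<partial>N) \<le> \<rho> * (norm (y - xstar))\<^sup>2" for y
    unfolding c_def rho
  proof (rule quantized_step_contraction[OF urq])
    show "0 < \<mu> + Lbar" using mu_pos le by simp
    show "\<mu> * Lbar * (norm (y - xstar))\<^sup>2 + (norm (G y))\<^sup>2 \<le> (\<mu> + Lbar) * (G y \<bullet> (y - xstar))"
      using strongly_convex_smooth_monotone[OF lower upper le, of y xstar] by (simp add: Gstar)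
  qed
  \<comment> \<open>\<open>\<rho>\<close> bounds an expected squared distance after a step from unit distance. Its sign is
    needed to multiply the induction hypothesis by \<open>\<rho>\<close>.\<close>
  have \<rho>: "0 \<le> \<rho>"
  proof -
    have "0 \<le> (\<integral>s. (norm (((xstar + e) - xstar) - c *\<^sub>R Q s (G (xstar + e))))\<^sup>2 \<partial>N)"
      by (rule Bochner_Integration.integral_nonneg) simp
    also have "\<dots> \<le> \<rho> * (norm ((xstar + e) - xstar))\<^sup>2" by (rule contr)
    finally show ?thesis using e by simp
  qed

  have "Lbar-lipschitz_on UNIV G"
    by (rule lipschitz_onI) (use lip le mu_pos in \<open>simp_all add: dist_norm\<close>)
  then have "continuous_on UNIV G"
    by (rule lipschitz_on_continuous_on)
  then have G_meas[measurable]: "G \<in> borel_measurable borel"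
    by (rule borel_measurable_continuous_onI)
  have Q_meas: "case_prod Q \<in> borel_measurable (N \<Otimes>\<^sub>M borel)"
    using urq by (simp add: unbiased_random_quantizer_def)
  have Q_comp[measurable]: "(\<lambda>p. Q (s p) (v p)) \<in> borel_measurable P"
    if [measurable]: "s \<in> measurable P N" "v \<in> borel_measurable P" for P :: "'p measure" and s v
    using measurable_compose[OF measurable_Pair[OF that] Q_meas] by simp
  have iter': "x (Suc k) w = x k w - c *\<^sub>R Q (\<xi> k w) (G (x k w))" if "w \<in> space M" for k w
    using iter[OF that] by (simp add: gradF step c_def)
  have T_meas: "case_prod (\<lambda>s y. y - c *\<^sub>R Q s (G y)) \<in> borel_measurable (N \<Otimes>\<^sub>M borel)"
    by (simp add: case_prod_unfold)
  have x_meas[measurable]: "x k \<in> borel_measurable M" for k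
    by (rule measurable_recursion[where x = x, OF fresh init iter' _ T_meas]) simp_all

  have bound: "(\<integral>\<^sup>+w. V k w \<partial>M) \<le> ennreal (\<rho> ^ k * (norm (x0 - xstar))\<^sup>2)" for k
  proof (induction k)
    case 0
    have "(\<integral>\<^sup>+w. V 0 w \<partial>M) = (\<integral>\<^sup>+w. ennreal ((norm (x0 - xstar))\<^sup>2) \<partial>M)"
      by (rule nn_integral_cong) (simp add: V_def init)
    then show ?case by (simp add: M.emeasure_space_1)
  next
    case (Suc k)
    have "(\<integral>\<^sup>+w. V (Suc k) w \<partial>M)
        = (\<integral>\<^sup>+w. ennreal ((norm ((x k w - xstar) - c *\<^sub>R Q (\<xi> k w) (G (x k w))))\<^sup>2) \<partial>M)"
      by (rule nn_integral_cong) (simp add: V_def iter' algebra_simps)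
    also have "\<dots> = (\<integral>\<^sup>+w. (\<integral>\<^sup>+s. ennreal ((norm ((x k w - xstar) - c *\<^sub>R Q s (G (x k w))))\<^sup>2) \<partial>N) \<partial>M)"
      by (rule nn_integral_fresh_seed[where x = x, OF fresh init iter' _ T_meas])
        (simp_all add: case_prod_unfold)
    also have "\<dots> \<le> (\<integral>\<^sup>+w. ennreal \<rho> * V k w \<partial>M)"
    proof (rule nn_integral_mono)
      fix w
      have "(\<integral>\<^sup>+s. ennreal ((norm ((x k w - xstar) - c *\<^sub>R Q s (G (x k w))))\<^sup>2) \<partial>N)
          = ennreal (\<integral>s. (norm ((x k w - xstar) - c *\<^sub>R Q s (G (x k w))))\<^sup>2 \<partial>N)"
        by (rule nn_integral_eq_integral[OF quantized_step_second_moment(1)[OF urq]]) simp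
      also have "\<dots> \<le> ennreal (\<rho> * (norm (x k w - xstar))\<^sup>2)"
        by (intro ennreal_leI contr)
      finally show "(\<integral>\<^sup>+s. ennreal ((norm ((x k w - xstar) - c *\<^sub>R Q s (G (x k w))))\<^sup>2) \<partial>N)
          \<le> ennreal \<rho> * V k w"
        using \<rho> by (simp add: V_def ennreal_mult)
    qed
    also have "\<dots> = ennreal \<rho> * (\<integral>\<^sup>+w. V k w \<partial>M)"
      unfolding V_def by (rule nn_integral_cmult) simp
    also have "\<dots> \<le> ennreal \<rho> * ennreal (\<rho> ^ k * (norm (x0 - xstar))\<^sup>2)"
      by (rule mult_left_mono[OF Suc]) simp
    also have "\<dots> = ennreal (\<rho> ^ Suc k * (norm (x0 - xstar))\<^sup>2)"
      using \<rho> by (simp add: ennreal_mult[symmetric] mult.assoc)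
    finally show ?case .
  qed

  show ?thesis
  proof (intro allI conjI)
    fix k
    have meas: "(\<lambda>w. (norm (x k w - xstar))\<^sup>2) \<in> borel_measurable M" by simp
    show int: "integrable M (\<lambda>w. (norm (x k w - xstar))\<^sup>2)"
      using bound[of k] meas unfolding V_def
      by (intro integrableI_nonneg) (auto intro: le_less_trans)
    have "ennreal (\<integral>w. (norm (x k w - xstar))\<^sup>2 \<partial>M) \<le> ennreal (\<rho> ^ k * (norm (x0 - xstar))\<^sup>2)"
      using bound[of k] unfolding V_def by (subst nn_integral_eq_integral[OF int, symmetric]) simp_all
    then show "(\<integral>w. (norm (x k w - xstar))\<^sup>2 \<partial>M) \<le> \<rho> ^ k * (norm (x0 - xstar))\<^sup>2"
      using \<rho> by (subst (asm) ennreal_le_iff) simp_all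
  qed
qed

end
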